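(* Let $G$ be a finite additive abelian group and $\Sigma=(\Gamma,\sigma)$ a signed graph with underlying graph $\Gamma=(V,E)$. The number of $G$-flows of $\Sigma$ equals $$|G|^{|E|-|V|+k_b(\Sigma)}\Big(\frac{|G|}{|2G|}\Big)^{k_u(\Sigma)}.$$
   Context: A signed graph $\Sigma=(\Gamma,\sigma)$: finite graph $\Gamma=(V,E)$ (loops, multiple edges allowed), $\sigma:E\to\{-1,1\}$. A cycle (loops included) is balanced if the product of its edge signs is $1$, unbalanced otherwise. $k_b(\Sigma)$, $k_u(\Sigma)$: numbers of connected components with all cycles balanced, resp. containing an unbalanced cycle. Each edge $e$ with endpoints $u,v$ has half-edges $(u,e),(v,e)$ (two half-edges at $v$ for a loop at $v$). An orientation $\omega$ assigns $\pm1$ to each half-edge, compatible with $\sigma$ if $\sigma(e)=-\omega(u,e)\omega(v,e)$ for each edge. A $G$-flow of $\Sigma$ is $f:E\to G$ such that, for a fixed orientation $\omega$ compatible with $\sigma$, at every vertex $v$, $\sum\omega(v,e)f(e)=0$ over all half-edges $(v,e)$ at $v$ (a loop contributes two terms); the count does not depend on the choice of $\omega$. $2G=\{x+x:x\in G\}$. *)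

theory Defs
  imports Complex_Main "HOL-Library.FuncSet"
begin

text \<open>
  Finite undirected multigraphs with loops. An edge \<open>e\<close> has exactly two half-edges, \<open>(e, False)\<close> and
  \<open>(e, True)\<close>, and \<open>endpt \<Gamma> h\<close> is the vertex at which the half-edge \<open>h\<close> is attached; for a loop both
  half-edges are attached at the same vertex. The labels \<open>False\<close> and \<open>True\<close> only tell the two
  half-edges of an edge apart.
\<close>

record ('v, 'e) multigraph =
  verts :: "'v set"
  edges :: "'e set"
  endpt :: "'e \<times> bool \<Rightarrow> 'v"

definition half_edges :: "('v, 'e) multigraph \<Rightarrow> ('e \<times> bool) set" where
  "half_edges \<Gamma> = edges \<Gamma> \<times> UNIV"

definition opposite :: "'e \<times> bool \<Rightarrow> 'e \<times> bool" where
  "opposite h = (fst h, \<not> snd h)"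

definition finite_multigraph :: "('v, 'e) multigraph \<Rightarrow> bool" where
  "finite_multigraph \<Gamma> \<longleftrightarrow>
     finite (verts \<Gamma>) \<and> finite (edges \<Gamma>) \<and> (\<forall>h\<in>half_edges \<Gamma>. endpt \<Gamma> h \<in> verts \<Gamma>)"

definition signed_graph :: "('v, 'e) multigraph \<Rightarrow> ('e \<Rightarrow> int) \<Rightarrow> bool" where
  "signed_graph \<Gamma> \<sigma> \<longleftrightarrow> finite_multigraph \<Gamma> \<and> (\<forall>e\<in>edges \<Gamma>. \<sigma> e \<in> {-1, 1})"

definition adjacent :: "('v, 'e) multigraph \<Rightarrow> 'v \<Rightarrow> 'v \<Rightarrow> bool" where
  "adjacent \<Gamma> u v \<longleftrightarrow> (\<exists>h\<in>half_edges \<Gamma>. endpt \<Gamma> h = u \<and> endpt \<Gamma> (opposite h) = v)"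

definition components :: "('v, 'e) multigraph \<Rightarrow> 'v set set" where
  "components \<Gamma> = verts \<Gamma> // {(u, v). u \<in> verts \<Gamma> \<and> v \<in> verts \<Gamma> \<and> (adjacent \<Gamma>)\<^sup>*\<^sup>* u v}"

text \<open>
  A cycle is listed as the half-edges through which its successive edges are entered: \<open>h\<close> stands for
  the traversal of the edge \<open>fst h\<close> from \<open>endpt \<Gamma> h\<close> to \<open>endpt \<Gamma> (opposite h)\<close>. Vertices and edges
  are not repeated; a loop is a cycle of length one, a pair of parallel edges one of length two.
\<close>

definition cycle :: "('v, 'e) multigraph \<Rightarrow> ('e \<times> bool) list \<Rightarrow> bool" where
  "cycle \<Gamma> c \<longleftrightarrow>
     c \<noteq> [] \<and> set c \<subseteq> half_edges \<Gamma> \<and>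
     (\<forall>i<length c. endpt \<Gamma> (opposite (c ! i)) = endpt \<Gamma> (c ! (Suc i mod length c))) \<and>
     distinct (map (endpt \<Gamma>) c) \<and> distinct (map fst c)"

definition balanced_cycle :: "('e \<Rightarrow> int) \<Rightarrow> ('e \<times> bool) list \<Rightarrow> bool" where
  "balanced_cycle \<sigma> c \<longleftrightarrow> (\<Prod>h\<leftarrow>c. \<sigma> (fst h)) = 1"

definition cycle_in :: "('v, 'e) multigraph \<Rightarrow> 'v set \<Rightarrow> ('e \<times> bool) list \<Rightarrow> bool" where
  "cycle_in \<Gamma> C c \<longleftrightarrow> cycle \<Gamma> c \<and> endpt \<Gamma> ` set c \<subseteq> C"

definition k_b :: "('v, 'e) multigraph \<Rightarrow> ('e \<Rightarrow> int) \<Rightarrow> nat" where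
  "k_b \<Gamma> \<sigma> = card {C \<in> components \<Gamma>. \<forall>c. cycle_in \<Gamma> C c \<longrightarrow> balanced_cycle \<sigma> c}"

definition k_u :: "('v, 'e) multigraph \<Rightarrow> ('e \<Rightarrow> int) \<Rightarrow> nat" where
  "k_u \<Gamma> \<sigma> = card {C \<in> components \<Gamma>. \<exists>c. cycle_in \<Gamma> C c \<and> \<not> balanced_cycle \<sigma> c}"

definition compatible_orientation ::
    "('v, 'e) multigraph \<Rightarrow> ('e \<Rightarrow> int) \<Rightarrow> ('e \<times> bool \<Rightarrow> int) \<Rightarrow> bool" where
  "compatible_orientation \<Gamma> \<sigma> \<omega> \<longleftrightarrow>
     (\<forall>h\<in>half_edges \<Gamma>. \<omega> h \<in> {-1, 1}) \<and>
     (\<forall>e\<in>edges \<Gamma>. \<sigma> e = - (\<omega> (e, False) * \<omega> (e, True)))"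

lemma compatible_orientation_exists:
  assumes "signed_graph \<Gamma> \<sigma>"
  shows "\<exists>\<omega>. compatible_orientation \<Gamma> \<sigma> \<omega>"
  using assms
  by (intro exI[of _ "\<lambda>(e, b). if b then - \<sigma> e else 1"])
     (auto simp: signed_graph_def compatible_orientation_def half_edges_def)

text \<open>The product \<open>s x\<close> of a sign \<open>s \<in> {-1, 1}\<close> and a group element \<open>x\<close>.\<close>

definition sign_mult :: "int \<Rightarrow> 'g::ab_group_add \<Rightarrow> 'g" where
  "sign_mult s x = (if s = 1 then x else - x)"

text \<open>Flows are functions on the edge set, so they are taken to be \<open>undefined\<close> off it.\<close>

definition flows ::
    "('v, 'e) multigraph \<Rightarrow> ('e \<times> bool \<Rightarrow> int) \<Rightarrow> ('e \<Rightarrow> 'g::ab_group_add) set" where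
  "flows \<Gamma> \<omega> =
     {f \<in> edges \<Gamma> \<rightarrow>\<^sub>E UNIV.
        \<forall>v\<in>verts \<Gamma>. (\<Sum>h\<in>{h \<in> half_edges \<Gamma>. endpt \<Gamma> h = v}. sign_mult (\<omega> h) (f (fst h))) = 0}"

end

theory Submission
  imports Defs
begin

text \<open>
  The flows form the kernel of the boundary map from edge weights to vertex weights, so it suffices to
  count its image. Modulo boundaries, a weight at a vertex can be moved along a walk if it is multiplied
  by the sign of the walk, hence every vertex weight is concentrated at chosen roots of the components
  by a signed sum. At the root of a balanced component only the weight 0 is a boundary; at the root of
  an unbalanced one an unbalanced closed walk identifies \<open>x\<close> with \<open>-x\<close>, and the boundaries are exactly
  the elements of \<open>2G\<close>. The image thus has \<open>|G|\<close> choices at each non-root vertex, 1 at a balanced root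
  and \<open>|2G|\<close> at an unbalanced root.
\<close>

section \<open>Signs\<close>

lemma sign_mult_add: "sign_mult s (x + y) = sign_mult s x + sign_mult s y"
  by (simp add: sign_mult_def)

lemma sign_mult_zero [simp]: "sign_mult s 0 = 0"
  by (simp add: sign_mult_def)

lemma sign_mult_one [simp]: "sign_mult 1 x = x"
  by (simp add: sign_mult_def)

lemma sign_mult_diff: "sign_mult s (x - y) = sign_mult s x - sign_mult s y"
  by (simp add: sign_mult_def)

lemma sign_mult_sum: "sign_mult s (\<Sum>i\<in>I. f i) = (\<Sum>i\<in>I. sign_mult s (f i))"
  by (simp add: sign_mult_def sum_negf)

lemma sign_mult_mult:
  assumes "s \<in> {-1, 1}" "t \<in> {-1, 1}"
  shows "sign_mult (s * t) x = sign_mult s (sign_mult t x)"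
  using assms by (auto simp: sign_mult_def)

lemma sign_mult_cancel: "sign_mult s x = sign_mult s y \<longleftrightarrow> x = y"
  by (simp add: sign_mult_def)

text \<open>The product of \<open>balanced_cycle\<close>, kept as a value so that it can be
  multiplied along concatenated walks.\<close>

definition walk_sign :: "('e \<Rightarrow> int) \<Rightarrow> ('e \<times> bool) list \<Rightarrow> int" where
  "walk_sign \<sigma> c = (\<Prod>h\<leftarrow>c. \<sigma> (fst h))"

lemma walk_sign_simps [simp]:
  "walk_sign \<sigma> [] = 1"
  "walk_sign \<sigma> (h # c) = \<sigma> (fst h) * walk_sign \<sigma> c"
  "walk_sign \<sigma> (c @ d) = walk_sign \<sigma> c * walk_sign \<sigma> d"
  by (simp_all add: walk_sign_def)

lemma walk_sign_reverse [simp]: "walk_sign \<sigma> (rev (map opposite c)) = walk_sign \<sigma> c"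
  by (induction c) (auto simp: opposite_def)

lemma half_edges_iff: "h \<in> half_edges \<Gamma> \<longleftrightarrow> fst h \<in> edges \<Gamma>"
  by (cases h) (simp add: half_edges_def)

lemma opposite_simps [simp]:
  "fst (opposite h) = fst h" "opposite (opposite h) = h"
  "opposite h \<in> half_edges \<Gamma> \<longleftrightarrow> h \<in> half_edges \<Gamma>"
  by (simp_all add: opposite_def half_edges_iff)

lemma same_edge_iff: "fst h = fst h' \<longleftrightarrow> h' = h \<or> h' = opposite h"
  by (cases h; cases h') (auto simp: opposite_def)

section \<open>Walks\<close>

fun walk :: "('v, 'e) multigraph \<Rightarrow> 'v \<Rightarrow> ('e \<times> bool) list \<Rightarrow> 'v \<Rightarrow> bool" where
  "walk \<Gamma> u [] v \<longleftrightarrow> u = v"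
| "walk \<Gamma> u (h # c) v \<longleftrightarrow>
     h \<in> half_edges \<Gamma> \<and> endpt \<Gamma> h = u \<and> walk \<Gamma> (endpt \<Gamma> (opposite h)) c v"

lemma walk_append: "walk \<Gamma> u (c @ d) v \<longleftrightarrow> (\<exists>w. walk \<Gamma> u c w \<and> walk \<Gamma> w d v)"
  by (induction c arbitrary: u) auto

lemma walk_reverse: "walk \<Gamma> u c v \<Longrightarrow> walk \<Gamma> v (rev (map opposite c)) u"
  by (induction c arbitrary: u) (auto simp: walk_append)

lemma walk_half_edges: "walk \<Gamma> u c v \<Longrightarrow> set c \<subseteq> half_edges \<Gamma>"
  by (induction c arbitrary: u) auto

lemma walk_reaches:
  assumes "walk \<Gamma> u c v" "h \<in> set c"
  shows "\<exists>d. walk \<Gamma> u d (endpt \<Gamma> h)"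
proof -
  obtain c1 c2 where "c = c1 @ h # c2"
    using assms(2) by (meson split_list)
  then show ?thesis
    using assms(1) by (auto simp: walk_append)
qed

lemma walk_iff_nth:
  "walk \<Gamma> u c v \<longleftrightarrow> set c \<subseteq> half_edges \<Gamma> \<and>
     (if c = [] then u = v else endpt \<Gamma> (hd c) = u \<and> endpt \<Gamma> (opposite (last c)) = v) \<and>
     (\<forall>i. Suc i < length c \<longrightarrow> endpt \<Gamma> (opposite (c ! i)) = endpt \<Gamma> (c ! Suc i))"
proof (induction c arbitrary: u)
  case (Cons h c)
  have "(\<forall>i. Suc i < length (h # c) \<longrightarrow>
           endpt \<Gamma> (opposite ((h # c) ! i)) = endpt \<Gamma> ((h # c) ! Suc i)) \<longleftrightarrow>
        (c \<noteq> [] \<longrightarrow> endpt \<Gamma> (opposite h) = endpt \<Gamma> (hd c)) \<and>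
        (\<forall>i. Suc i < length c \<longrightarrow> endpt \<Gamma> (opposite (c ! i)) = endpt \<Gamma> (c ! Suc i))"
    by (auto simp: hd_conv_nth nth_Cons split: nat.splits)
  then show ?case
    by (auto simp: Cons.IH)
qed auto

section \<open>Closed walks and cycles\<close>

text \<open>This translates between recursive walks and the cyclic indexing of \<open>cycle\<close>.
  The last index, where the successor wraps round to 0, carries the closing condition; the other
  indices say that consecutive half-edges fit together.\<close>

lemma closed_walk_iff_nth:
  assumes "c \<noteq> []"
  shows "walk \<Gamma> (endpt \<Gamma> (hd c)) c (endpt \<Gamma> (hd c)) \<longleftrightarrow> set c \<subseteq> half_edges \<Gamma> \<and>
     (\<forall>i<length c. endpt \<Gamma> (opposite (c ! i)) = endpt \<Gamma> (c ! (Suc i mod length c)))"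
proof -
  have "(\<forall>i<length c. endpt \<Gamma> (opposite (c ! i)) = endpt \<Gamma> (c ! (Suc i mod length c))) \<longleftrightarrow>
        endpt \<Gamma> (opposite (last c)) = endpt \<Gamma> (hd c) \<and>
        (\<forall>i. Suc i < length c \<longrightarrow> endpt \<Gamma> (opposite (c ! i)) = endpt \<Gamma> (c ! Suc i))"
    (is "?L \<longleftrightarrow> ?R")
  proof
    assume L: ?L
    have "endpt \<Gamma> (opposite (c ! (length c - 1))) = endpt \<Gamma> (c ! (Suc (length c - 1) mod length c))"
      using L assms by simp
    then have "endpt \<Gamma> (opposite (last c)) = endpt \<Gamma> (hd c)"
      using assms by (simp add: last_conv_nth hd_conv_nth)
    moreover have "endpt \<Gamma> (opposite (c ! i)) = endpt \<Gamma> (c ! Suc i)" if "Suc i < length c" for i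
      using L that by (metis Suc_lessD mod_less)
    ultimately show ?R by blast
  next
    assume R: ?R
    show ?L
    proof (intro allI impI)
      fix i assume i: "i < length c"
      show "endpt \<Gamma> (opposite (c ! i)) = endpt \<Gamma> (c ! (Suc i mod length c))"
      proof (cases "Suc i = length c")
        case True
        then have "i = length c - 1" by simp
        then show ?thesis
          using R True assms by (simp add: last_conv_nth hd_conv_nth)
      next
        case False
        then show ?thesis using R i by simp
      qed
    qed
  qed
  then show ?thesis
    using assms by (subst walk_iff_nth) auto
qed

text \<open>
  With distinct vertices, an edge can only be repeated when the walk runs through it back and forth,
  and then its sign is a square.
\<close>

lemma closed_walk_is_cycle:
  assumes walk: "walk \<Gamma> u c u" and dist: "distinct (map (endpt \<Gamma>) c)"
    and signs: "\<forall>e\<in>edges \<Gamma>. \<sigma> e \<in> {-1, 1}" and neg: "walk_sign \<sigma> c \<noteq> 1"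
  shows "cycle \<Gamma> c"
proof -
  have ne: "c \<noteq> []" using neg by auto
  have "u = endpt \<Gamma> (hd c)" using walk ne by (cases c) auto
  then have sub: "set c \<subseteq> half_edges \<Gamma>"
    and nxt: "\<And>i. i < length c \<Longrightarrow> endpt \<Gamma> (opposite (c ! i)) = endpt \<Gamma> (c ! (Suc i mod length c))"
    using walk closed_walk_iff_nth[OF ne] by auto
  have inj: "i = j" if "i < length c" "j < length c" "endpt \<Gamma> (c ! i) = endpt \<Gamma> (c ! j)" for i j
    using dist that by (metis length_map nth_map nth_eq_iff_index_eq)
  have "distinct (map fst c)"
  proof (rule ccontr)
    assume "\<not> distinct (map fst c)"
    then obtain i j where ij: "i < j" "j < length c" "fst (c ! i) = fst (c ! j)"
      by (auto simp: distinct_conv_nth) (metis linorder_neqE_nat)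
    then have opp: "c ! j = opposite (c ! i)"
      using inj[of i j] by (auto simp: same_edge_iff)
    \<comment> \<open>Crossing \<open>c ! i\<close> ends where its opposite \<open>c ! j\<close>
      starts, so by distinctness of vertices \<open>j\<close> is the cyclic successor of
      \<open>i\<close>. Likewise \<open>i\<close> is that of \<open>j\<close>, which forces length
      two.\<close>
    have "Suc i mod length c = j"
      using nxt[of i] ij opp by (intro inj) auto
    then have j: "j = Suc i" using ij by simp
    have "Suc j mod length c = i"
      using nxt[of j] ij opp ne by (intro inj) auto
    then have "i = 0 \<and> length c = 2"
      using ij j by (cases "Suc j = length c") auto
    then have "c = [c ! 0, opposite (c ! 0)]"
      using j opp by (intro nth_equalityI) (auto simp: less_Suc_eq numeral_2_eq_2)
    moreover have "c ! 0 \<in> half_edges \<Gamma>"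
      using sub ne by (meson length_greater_0_conv nth_mem subsetD)
    then have "\<sigma> (fst (c ! 0)) \<in> {-1, 1}"
      using signs by (simp add: half_edges_iff)
    moreover have "walk_sign \<sigma> [h, opposite h] = 1" if "\<sigma> (fst h) \<in> {-1, 1}" for h
      using that by auto
    ultimately have "walk_sign \<sigma> c = 1"
      by metis
    then show False using neg by simp
  qed
  then show ?thesis
    using ne sub nxt dist by (auto simp: cycle_def)
qed

text \<open>Strong induction on the length. A repeated vertex cuts the walk into two shorter closed
  walks whose signs multiply to the sign of the whole, so they cannot both have sign 1.\<close>

lemma unbalanced_closed_walk_contains_cycle:
  assumes "walk \<Gamma> u c u" "walk_sign \<sigma> c \<noteq> 1" "\<forall>e\<in>edges \<Gamma>. \<sigma> e \<in> {-1, 1}"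
  shows "\<exists>d. cycle \<Gamma> d \<and> set d \<subseteq> set c \<and> \<not> balanced_cycle \<sigma> d"
  using assms(1,2)
proof (induction "length c" arbitrary: c u rule: less_induct)
  case less
  show ?case
  proof (cases "distinct (map (endpt \<Gamma>) c)")
    case True
    have "cycle \<Gamma> c"
      by (rule closed_walk_is_cycle[OF less.prems(1) True assms(3) less.prems(2)])
    then show ?thesis
      using less.prems(2) unfolding balanced_cycle_def walk_sign_def by blast
  next
    case False
    obtain as' bs' ds' w where "map (endpt \<Gamma>) c = as' @ [w] @ bs' @ [w] @ ds'"
      using not_distinct_decomp[OF False] by blast
    then have "map (endpt \<Gamma>) c = as' @ w # bs' @ w # ds'"
      by simp
    \<comment> \<open>The decomposition of the vertex list is pulled back, piece by piece, to the
      list of half-edges.\<close>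
    then obtain as c' where "c = as @ c'" "map (endpt \<Gamma>) c' = w # bs' @ w # ds'"
      by (auto simp: map_eq_append_conv)
    moreover from this(2) obtain x c''
      where "c' = x # c''" "endpt \<Gamma> x = w" "map (endpt \<Gamma>) c'' = bs' @ w # ds'"
      by (cases c') auto
    moreover from this(3) obtain bs d where "c'' = bs @ d" "map (endpt \<Gamma>) d = w # ds'"
      by (auto simp: map_eq_append_conv)
    moreover from this(2) obtain y ds where "d = y # ds" "endpt \<Gamma> y = w"
      by (cases d) auto
    ultimately have c: "c = as @ x # bs @ y # ds" and w: "endpt \<Gamma> x = w" "endpt \<Gamma> y = w"
      by simp_all
    have inner: "walk \<Gamma> w (x # bs) w" and outer: "walk \<Gamma> u (as @ y # ds) u"
      using less.prems(1) w unfolding c by (auto simp: walk_append)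
    have "walk_sign \<sigma> c = walk_sign \<sigma> (x # bs) * walk_sign \<sigma> (as @ y # ds)"
      unfolding c by simp
    then consider "walk_sign \<sigma> (x # bs) \<noteq> 1" | "walk_sign \<sigma> (as @ y # ds) \<noteq> 1"
      using less.prems(2) by fastforce
    then show ?thesis
    proof cases
      case 1
      then show ?thesis
        using less.hyps[OF _ inner] unfolding c by fastforce
    next
      case 2
      then show ?thesis
        using less.hyps[OF _ outer] unfolding c by fastforce
    qed
  qed
qed

lemma adjacent_rtranclp_iff_walk: "(adjacent \<Gamma>)\<^sup>*\<^sup>* u v \<longleftrightarrow> (\<exists>c. walk \<Gamma> u c v)"
proof
  assume "(adjacent \<Gamma>)\<^sup>*\<^sup>* u v"
  then show "\<exists>c. walk \<Gamma> u c v"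
  proof (induction rule: converse_rtranclp_induct)
    case base
    show ?case by (rule exI[of _ "[]"]) simp
  next
    case (step u w)
    then obtain h c where "h \<in> half_edges \<Gamma>" "endpt \<Gamma> h = u" "endpt \<Gamma> (opposite h) = w" "walk \<Gamma> w c v"
      by (auto simp: adjacent_def)
    then have "walk \<Gamma> u (h # c) v" by simp
    then show ?case by blast
  qed
next
  assume "\<exists>c. walk \<Gamma> u c v"
  then obtain c where "walk \<Gamma> u c v" ..
  then show "(adjacent \<Gamma>)\<^sup>*\<^sup>* u v"
  proof (induction c arbitrary: u)
    case (Cons h c)
    then have "adjacent \<Gamma> u (endpt \<Gamma> (opposite h))"
      by (auto simp: adjacent_def)
    then show ?case
      using Cons by (auto intro: converse_rtranclp_into_rtranclp)
  qed simp
qed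

section \<open>Boundaries and roots of components\<close>

text \<open>The signed incidence matrix acting on edge weights. Its kernel is the set of flows, up
  to values off the edge set.\<close>

definition boundary ::
    "('v, 'e) multigraph \<Rightarrow> ('e \<times> bool \<Rightarrow> int) \<Rightarrow> ('e \<Rightarrow> 'g::ab_group_add) \<Rightarrow> 'v \<Rightarrow> 'g" where
  "boundary \<Gamma> \<omega> f v = (\<Sum>h\<in>{h \<in> half_edges \<Gamma>. endpt \<Gamma> h = v}. sign_mult (\<omega> h) (f (fst h)))"

lemma boundary_add: "boundary \<Gamma> \<omega> (\<lambda>e. f e + f' e) v = boundary \<Gamma> \<omega> f v + boundary \<Gamma> \<omega> f' v"
  by (simp add: boundary_def sign_mult_add sum.distrib)

lemma boundary_diff: "boundary \<Gamma> \<omega> (\<lambda>e. f e - f' e) v = boundary \<Gamma> \<omega> f v - boundary \<Gamma> \<omega> f' v"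
  by (simp add: boundary_def sign_mult_diff sum_subtractf)

lemma boundary_cong:
  assumes "\<And>e. e \<in> edges \<Gamma> \<Longrightarrow> f e = f' e"
  shows "boundary \<Gamma> \<omega> f v = boundary \<Gamma> \<omega> f' v"
  unfolding boundary_def using assms by (intro sum.cong) (auto simp: half_edges_iff)

definition doubles :: "'g::ab_group_add set" where
  "doubles = {x + x | x. True}"

lemma sum_in_doubles:
  assumes "\<And>i. i \<in> I \<Longrightarrow> f i \<in> doubles"
  shows "(\<Sum>i\<in>I. f i) \<in> doubles"
proof -
  have "\<forall>i\<in>I. \<exists>x. f i = x + x"
    using assms by (auto simp: doubles_def)
  then obtain y where "\<forall>i\<in>I. f i = y i + y i"
    by metis
  then have "(\<Sum>i\<in>I. f i) = (\<Sum>i\<in>I. y i) + (\<Sum>i\<in>I. y i)"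
    by (simp add: sum.distrib)
  then show ?thesis
    unfolding doubles_def by blast
qed

locale oriented_signed_graph =
  fixes \<Gamma> :: "('v, 'e) multigraph" and \<sigma> :: "'e \<Rightarrow> int" and \<omega> :: "'e \<times> bool \<Rightarrow> int"
  assumes signed: "signed_graph \<Gamma> \<sigma>"
    and compatible: "compatible_orientation \<Gamma> \<sigma> \<omega>"
begin

lemma finite_verts: "finite (verts \<Gamma>)"
  and finite_edges: "finite (edges \<Gamma>)"
  and endpt_in_verts: "h \<in> half_edges \<Gamma> \<Longrightarrow> endpt \<Gamma> h \<in> verts \<Gamma>"
  and sign_cases: "e \<in> edges \<Gamma> \<Longrightarrow> \<sigma> e \<in> {-1, 1}"
  using signed by (auto simp: signed_graph_def finite_multigraph_def)

lemma finite_half_edges: "finite (half_edges \<Gamma>)"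
  by (simp add: half_edges_def finite_edges)

lemma orientation_cases: "h \<in> half_edges \<Gamma> \<Longrightarrow> \<omega> h \<in> {-1, 1}"
  using compatible by (auto simp: compatible_orientation_def)

lemma sign_eq_orientation:
  assumes "h \<in> half_edges \<Gamma>"
  shows "\<sigma> (fst h) = - (\<omega> h * \<omega> (opposite h))"
proof -
  obtain e b where h: "h = (e, b)" by (cases h)
  then have "e \<in> edges \<Gamma>" using assms by (simp add: half_edges_iff)
  then show ?thesis
    using compatible h by (cases b) (auto simp: compatible_orientation_def opposite_def)
qed

lemma walk_sign_cases: "walk \<Gamma> u c v \<Longrightarrow> walk_sign \<sigma> c \<in> {-1, 1}"
proof (induction c arbitrary: u)
  case (Cons h c)
  then have "\<sigma> (fst h) \<in> {-1, 1}" "walk_sign \<sigma> c \<in> {-1, 1}"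
    using sign_cases by (auto simp: half_edges_iff)
  then show ?case by auto
qed simp

section \<open>Roots and potentials\<close>

lemma walk_in_verts: "walk \<Gamma> u c v \<Longrightarrow> u \<in> verts \<Gamma> \<Longrightarrow> v \<in> verts \<Gamma>"
  by (induction c arbitrary: u) (auto simp: endpt_in_verts)

text \<open>The choice depends only on the set of vertices reachable from \<open>v\<close>, so all
  vertices of a component get literally the same root.\<close>

definition root_of :: "'v \<Rightarrow> 'v" where
  "root_of v = (SOME u. \<exists>c. walk \<Gamma> v c u)"

text \<open>In an unbalanced component other walks to the root can have the opposite sign. Later
  arguments use only that some walk has this sign, as recorded in
  \<open>walk_to_root\<close>.\<close>

definition potential :: "'v \<Rightarrow> int" where
  "potential v = walk_sign \<sigma> (SOME c. walk \<Gamma> v c (root_of v))"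

lemma walk_to_root: "\<exists>c. walk \<Gamma> v c (root_of v) \<and> walk_sign \<sigma> c = potential v"
proof -
  have "walk \<Gamma> v [] v" by simp
  then have "\<exists>c. walk \<Gamma> v c (root_of v)"
    unfolding root_of_def by (intro someI[of "\<lambda>u. \<exists>c. walk \<Gamma> v c u" v]) blast
  then have "walk \<Gamma> v (SOME c. walk \<Gamma> v c (root_of v)) (root_of v)"
    by (rule someI_ex)
  then show ?thesis
    unfolding potential_def by blast
qed

lemma potential_cases: "potential v \<in> {-1, 1}"
  using walk_to_root walk_sign_cases by metis

lemma root_in_verts: "v \<in> verts \<Gamma> \<Longrightarrow> root_of v \<in> verts \<Gamma>"
  using walk_to_root walk_in_verts by metis

lemma root_eq_iff: "root_of u = root_of v \<longleftrightarrow> (\<exists>c. walk \<Gamma> u c v)"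
proof
  assume "root_of u = root_of v"
  moreover obtain c d where "walk \<Gamma> u c (root_of u)" "walk \<Gamma> v d (root_of v)"
    using walk_to_root by meson
  ultimately have "walk \<Gamma> u (c @ rev (map opposite d)) v"
    using walk_reverse by (fastforce simp: walk_append)
  then show "\<exists>c. walk \<Gamma> u c v" ..
next
  assume "\<exists>c. walk \<Gamma> u c v"
  then obtain c where c: "walk \<Gamma> u c v" ..
  \<comment> \<open>Both roots are chosen by \<open>SOME\<close>, so equal reachability predicates
    give equal roots.\<close>
  have "(\<exists>d. walk \<Gamma> u d w) \<longleftrightarrow> (\<exists>d. walk \<Gamma> v d w)" for w
  proof
    assume "\<exists>d. walk \<Gamma> u d w"
    then obtain d where "walk \<Gamma> u d w" ..
    then have "walk \<Gamma> v (rev (map opposite c) @ d) w"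
      using walk_reverse[OF c] by (auto simp: walk_append)
    then show "\<exists>d. walk \<Gamma> v d w" ..
  next
    assume "\<exists>d. walk \<Gamma> v d w"
    then obtain d where "walk \<Gamma> v d w" ..
    then have "walk \<Gamma> u (c @ d) w"
      using c by (auto simp: walk_append)
    then show "\<exists>d. walk \<Gamma> u d w" ..
  qed
  then show "root_of u = root_of v"
    unfolding root_of_def by presburger
qed

lemma root_root [simp]: "root_of (root_of v) = root_of v"
  using root_eq_iff walk_to_root by metis

definition roots :: "'v set" where
  "roots = root_of ` verts \<Gamma>"

definition root_class :: "'v \<Rightarrow> 'v set" where
  "root_class r = {v \<in> verts \<Gamma>. root_of v = r}"

lemma roots_subset: "roots \<subseteq> verts \<Gamma>"
  by (auto simp: roots_def root_in_verts)

lemma finite_roots: "finite roots"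
  by (simp add: roots_def finite_verts)

lemma finite_root_class: "finite (root_class r)"
  by (simp add: root_class_def finite_verts)

lemma root_of_root: "r \<in> roots \<Longrightarrow> root_of r = r"
  by (auto simp: roots_def)

lemma root_in_class: "r \<in> roots \<Longrightarrow> r \<in> root_class r"
  using roots_subset by (auto simp: root_class_def root_of_root)

lemma components_eq: "components \<Gamma> = root_class ` roots"
proof -
  have "{(u, v). u \<in> verts \<Gamma> \<and> v \<in> verts \<Gamma> \<and> (adjacent \<Gamma>)\<^sup>*\<^sup>* u v} `` {x} = root_class (root_of x)"
    if "x \<in> verts \<Gamma>" for x
    using that root_eq_iff[of x] unfolding root_class_def
    by (auto simp: adjacent_rtranclp_iff_walk eq_commute)
  then show ?thesis
    unfolding components_def quotient_def roots_def by auto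
qed

lemma inj_on_root_class: "inj_on root_class roots"
proof (rule inj_onI)
  fix r r' assume "r \<in> roots" "r' \<in> roots" "root_class r = root_class r'"
  then have "r \<in> root_class r'" using root_in_class by blast
  then show "r = r'" using \<open>r \<in> roots\<close> by (simp add: root_class_def root_of_root)
qed

section \<open>Balance of a component, seen from its root\<close>

definition unbalanced_root :: "'v \<Rightarrow> bool" where
  "unbalanced_root r \<longleftrightarrow> (\<exists>c. walk \<Gamma> r c r \<and> walk_sign \<sigma> c \<noteq> 1)"

text \<open>Closed walks at the root can be concatenated, unlike cycles, and they detect balance
  equally well: an unbalanced one contains an unbalanced cycle, and such a cycle can be reached from
  the root and left again along the same walk.\<close>

lemma unbalanced_root_iff_cycle:
  assumes r: "r \<in> roots"
  shows "unbalanced_root r \<longleftrightarrow> (\<exists>c. cycle_in \<Gamma> (root_class r) c \<and> \<not> balanced_cycle \<sigma> c)"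
proof
  assume "unbalanced_root r"
  then obtain c where c: "walk \<Gamma> r c r" "walk_sign \<sigma> c \<noteq> 1"
    by (auto simp: unbalanced_root_def)
  then obtain d where d: "cycle \<Gamma> d" "set d \<subseteq> set c" "\<not> balanced_cycle \<sigma> d"
    using unbalanced_closed_walk_contains_cycle[OF c] sign_cases by meson
  have "endpt \<Gamma> h \<in> root_class r" if "h \<in> set d" for h
  proof -
    have "h \<in> set c" using that d(2) by blast
    then have "root_of r = root_of (endpt \<Gamma> h)" "endpt \<Gamma> h \<in> verts \<Gamma>"
      using walk_reaches[OF c(1)] walk_half_edges[OF c(1)]
      by (auto simp: root_eq_iff endpt_in_verts)
    then show ?thesis
      using r by (simp add: root_class_def root_of_root)
  qed
  then show "\<exists>c. cycle_in \<Gamma> (root_class r) c \<and> \<not> balanced_cycle \<sigma> c"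
    using d by (auto simp: cycle_in_def)
next
  assume "\<exists>c. cycle_in \<Gamma> (root_class r) c \<and> \<not> balanced_cycle \<sigma> c"
  then obtain c where c: "cycle \<Gamma> c" "endpt \<Gamma> ` set c \<subseteq> root_class r" "walk_sign \<sigma> c \<noteq> 1"
    by (auto simp: cycle_in_def balanced_cycle_def walk_sign_def)
  define u where "u = endpt \<Gamma> (hd c)"
  have "c \<noteq> []" using c(1) by (simp add: cycle_def)
  then have closed: "walk \<Gamma> u c u" and "u \<in> root_class r"
    using c(1,2) unfolding u_def by (auto simp: closed_walk_iff_nth cycle_def)
  then obtain d where d: "walk \<Gamma> u d r"
    using walk_to_root by (auto simp: root_class_def)
  have "walk \<Gamma> r (rev (map opposite d) @ c @ d) r"
    using walk_reverse[OF d] closed d by (auto simp: walk_append)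
  \<comment> \<open>The connecting walk is used twice, so its sign squares to 1.\<close>
  moreover have "walk_sign \<sigma> (rev (map opposite d) @ c @ d) \<noteq> 1"
    using c(3) walk_sign_cases[OF d] by auto
  ultimately show "unbalanced_root r"
    unfolding unbalanced_root_def by blast
qed

lemma k_u_eq: "k_u \<Gamma> \<sigma> = card {r \<in> roots. unbalanced_root r}"
proof -
  have "{C \<in> components \<Gamma>. \<exists>c. cycle_in \<Gamma> C c \<and> \<not> balanced_cycle \<sigma> c} =
        root_class ` {r \<in> roots. unbalanced_root r}"
    unfolding components_eq using unbalanced_root_iff_cycle by blast
  then show ?thesis
    unfolding k_u_def by (simp add: card_image inj_on_subset[OF inj_on_root_class])
qed

lemma k_b_eq: "k_b \<Gamma> \<sigma> = card {r \<in> roots. \<not> unbalanced_root r}"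
proof -
  have "{C \<in> components \<Gamma>. \<forall>c. cycle_in \<Gamma> C c \<longrightarrow> balanced_cycle \<sigma> c} =
        root_class ` {r \<in> roots. \<not> unbalanced_root r}"
    unfolding components_eq using unbalanced_root_iff_cycle by blast
  then show ?thesis
    unfolding k_b_def by (simp add: card_image inj_on_subset[OF inj_on_root_class])
qed

section \<open>The image of the boundary map\<close>

text \<open>The total weight arriving at \<open>r\<close> when every weight of the component is
  moved there along a walk of sign \<open>potential\<close>. It is the invariant that decides
  whether \<open>g\<close> is a boundary.\<close>

definition root_sum :: "('v \<Rightarrow> 'g::ab_group_add) \<Rightarrow> 'v \<Rightarrow> 'g" where
  "root_sum g r = (\<Sum>v\<in>root_class r. sign_mult (potential v) (g v))"

definition allowed :: "'v \<Rightarrow> 'g::ab_group_add set" where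
  "allowed r = (if unbalanced_root r then doubles else {0})"

lemma sum_over_verts_by_root:
  "(\<Sum>v\<in>verts \<Gamma>. f v) = (\<Sum>r\<in>roots. \<Sum>v\<in>root_class r. f v)"
  unfolding root_class_def roots_def by (rule sum.group[symmetric]) (auto simp: finite_verts)

text \<open>Exchanging summation over vertices for summation over half-edges isolates the
  contribution of each edge, so that root sums of boundaries can be examined one edge at a
  time.\<close>

lemma root_sum_boundary:
  fixes f :: "'e \<Rightarrow> 'g::ab_group_add"
  shows "root_sum (boundary \<Gamma> \<omega> f) r =
     (\<Sum>e\<in>{e \<in> edges \<Gamma>. root_of (endpt \<Gamma> (e, False)) = r}.
        sign_mult (potential (endpt \<Gamma> (e, False)) * \<omega> (e, False)) (f e) +
        sign_mult (potential (endpt \<Gamma> (e, True)) * \<omega> (e, True)) (f e))"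
proof -
  let ?t = "\<lambda>h. sign_mult (potential (endpt \<Gamma> h) * \<omega> h) (f (fst h))"
  have edge: "root_of (endpt \<Gamma> (e, True)) = root_of (endpt \<Gamma> (e, False))" if "e \<in> edges \<Gamma>" for e
  proof -
    have "walk \<Gamma> (endpt \<Gamma> (e, True)) [(e, True)] (endpt \<Gamma> (e, False))"
      using that by (simp add: half_edges_iff opposite_def)
    then show ?thesis using root_eq_iff by blast
  qed
  have "root_sum (boundary \<Gamma> \<omega> f) r =
      (\<Sum>v\<in>root_class r. \<Sum>h\<in>{h \<in> {h \<in> half_edges \<Gamma>. root_of (endpt \<Gamma> h) = r}. endpt \<Gamma> h = v}. ?t h)"
    unfolding root_sum_def boundary_def sign_mult_sum
    by (intro sum.cong) (auto simp: root_class_def sign_mult_mult[OF potential_cases orientation_cases])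
  also have "\<dots> = (\<Sum>h\<in>{h \<in> half_edges \<Gamma>. root_of (endpt \<Gamma> h) = r}. ?t h)"
    by (intro sum.group) (auto simp: finite_half_edges finite_verts root_class_def endpt_in_verts)
  \<comment> \<open>Both half-edges of an edge lie in the same component, so testing the one
    labelled \<open>False\<close> suffices.\<close>
  also have "{h \<in> half_edges \<Gamma>. root_of (endpt \<Gamma> h) = r} =
      {e \<in> edges \<Gamma>. root_of (endpt \<Gamma> (e, False)) = r} \<times> UNIV"
  proof (rule set_eqI)
    fix h :: "'e \<times> bool"
    obtain e b where h: "h = (e, b)" by (cases h)
    have "root_of (endpt \<Gamma> (e, b)) = root_of (endpt \<Gamma> (e, False))" if "e \<in> edges \<Gamma>"
      using edge[OF that] by (cases b) auto
    then show "h \<in> {h \<in> half_edges \<Gamma>. root_of (endpt \<Gamma> h) = r} \<longleftrightarrow>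
        h \<in> {e \<in> edges \<Gamma>. root_of (endpt \<Gamma> (e, False)) = r} \<times> UNIV"
      unfolding h half_edges_def by (cases "e \<in> edges \<Gamma>") simp_all
  qed
  also have "(\<Sum>h\<in>\<dots>. ?t h) =
      (\<Sum>e\<in>{e \<in> edges \<Gamma>. root_of (endpt \<Gamma> (e, False)) = r}. \<Sum>b\<in>UNIV. ?t (e, b))"
    by (simp add: sum.cartesian_product case_prod_unfold)
  finally show ?thesis
    by (simp add: UNIV_bool)
qed

text \<open>Each edge contributes two signed copies of one element, which add up to an element of
  2G. In a balanced component the two signs are opposite and the copies cancel.\<close>

lemma root_sum_boundary_allowed:
  fixes f :: "'e \<Rightarrow> 'g::ab_group_add"
  shows "root_sum (boundary \<Gamma> \<omega> f) r \<in> allowed r"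
proof (cases "unbalanced_root r")
  case True
  have "sign_mult s x + sign_mult t x \<in> doubles" for s t and x :: 'g
  proof -
    have "x + x \<in> doubles" "- x + - x \<in> doubles" "0 + 0 \<in> (doubles :: 'g set)"
      unfolding doubles_def by blast+
    then show ?thesis
      by (auto simp: sign_mult_def)
  qed
  then show ?thesis
    unfolding allowed_def root_sum_boundary using True by (auto intro: sum_in_doubles)
next
  case False
  have "sign_mult (potential (endpt \<Gamma> (e, False)) * \<omega> (e, False)) (f e) +
        sign_mult (potential (endpt \<Gamma> (e, True)) * \<omega> (e, True)) (f e) = 0"
    if e: "e \<in> edges \<Gamma>" and r: "root_of (endpt \<Gamma> (e, False)) = r" for e
  proof -
    let ?u = "endpt \<Gamma> (e, False)" and ?v = "endpt \<Gamma> (e, True)"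
    have h: "(e, False) \<in> half_edges \<Gamma>" "(e, True) \<in> half_edges \<Gamma>"
      using e by (simp_all add: half_edges_iff)
    have uv: "walk \<Gamma> ?u [(e, False)] ?v"
      using h by (simp add: opposite_def)
    then have "root_of ?v = r"
      using r root_eq_iff by metis
    then obtain c d where c: "walk \<Gamma> ?u c r" "walk_sign \<sigma> c = potential ?u"
      and d: "walk \<Gamma> ?v d r" "walk_sign \<sigma> d = potential ?v"
      using walk_to_root r by metis
    \<comment> \<open>From the root to one end of the edge, across it, and back to the root: balance
      gives this closed walk sign 1, hence \<open>\<sigma> e\<close> is the product of the two
      potentials.\<close>
    have "walk \<Gamma> r (rev (map opposite c) @ [(e, False)] @ d) r"
      using walk_reverse[OF c(1)] uv d(1) unfolding walk_append by blast
    then have "walk_sign \<sigma> (rev (map opposite c) @ [(e, False)] @ d) = 1"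
      using False unfolding unbalanced_root_def by blast
    then have "potential ?u * (\<sigma> e * potential ?v) = 1"
      by (simp add: c d)
    moreover have "\<sigma> e = - (\<omega> (e, False) * \<omega> (e, True))"
      using sign_eq_orientation[OF h(1)] by (simp add: opposite_def)
    ultimately show ?thesis
      using potential_cases[of ?u] potential_cases[of ?v] orientation_cases[OF h(1)]
        orientation_cases[OF h(2)] by (auto simp: sign_mult_def)
  qed
  then show ?thesis
    unfolding allowed_def root_sum_boundary using False by simp
qed

section \<open>Constructing boundaries\<close>

definition is_boundary :: "('v \<Rightarrow> 'g::ab_group_add) \<Rightarrow> bool" where
  "is_boundary g \<longleftrightarrow> (\<exists>f. \<forall>v\<in>verts \<Gamma>. boundary \<Gamma> \<omega> f v = g v)"

definition point :: "'v \<Rightarrow> 'g::ab_group_add \<Rightarrow> 'v \<Rightarrow> 'g" where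
  "point v x w = (if w = v then x else 0)"

lemma point_sum: "point v (\<Sum>i\<in>I. f i) w = (\<Sum>i\<in>I. point v (f i) w)"
  by (simp add: point_def)

lemma is_boundary_zero: "is_boundary (\<lambda>_. 0)"
  unfolding is_boundary_def by (rule exI[of _ "\<lambda>_. 0"]) (simp add: boundary_def)

lemma is_boundary_add:
  assumes "is_boundary g" "is_boundary g'"
  shows "is_boundary (\<lambda>v. g v + g' v)"
proof -
  obtain f f' where "\<forall>v\<in>verts \<Gamma>. boundary \<Gamma> \<omega> f v = g v" "\<forall>v\<in>verts \<Gamma>. boundary \<Gamma> \<omega> f' v = g' v"
    using assms unfolding is_boundary_def by blast
  then show ?thesis
    unfolding is_boundary_def by (intro exI[of _ "\<lambda>e. f e + f' e"]) (simp add: boundary_add)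
qed

lemma is_boundary_sum:
  assumes "finite I" "\<And>i. i \<in> I \<Longrightarrow> is_boundary (g i)"
  shows "is_boundary (\<lambda>v. \<Sum>i\<in>I. g i v)"
  using assms by (induction I) (auto simp: is_boundary_zero intro: is_boundary_add)

lemma is_boundary_cong:
  assumes "is_boundary g" "\<And>v. v \<in> verts \<Gamma> \<Longrightarrow> g v = g' v"
  shows "is_boundary g'"
  using assms unfolding is_boundary_def by auto

lemma is_boundary_edge:
  assumes h: "h \<in> half_edges \<Gamma>"
  shows "is_boundary (\<lambda>w. point (endpt \<Gamma> h) x w -
           point (endpt \<Gamma> (opposite h)) (sign_mult (\<sigma> (fst h)) x) w)"
proof -
  \<comment> \<open>A weight on one edge only. The factor \<open>\<omega> h\<close> makes the
    contribution of \<open>h\<close> equal to \<open>x\<close>; at the opposite half-edge the two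
    orientations multiply to \<open>- \<sigma> (fst h)\<close>.\<close>
  define f where "f e = (if e = fst h then sign_mult (\<omega> h) x else 0)" for e
  have off: "f (fst h') = 0" if "h' \<notin> {h, opposite h}" for h'
    using that same_edge_iff[of h h'] by (auto simp: f_def)
  have "boundary \<Gamma> \<omega> f w = point (endpt \<Gamma> h) x w -
          point (endpt \<Gamma> (opposite h)) (sign_mult (\<sigma> (fst h)) x) w" for w
  proof -
    have "boundary \<Gamma> \<omega> f w =
        (\<Sum>h'\<in>half_edges \<Gamma>. if endpt \<Gamma> h' = w then sign_mult (\<omega> h') (f (fst h')) else 0)"
      unfolding boundary_def by (rule sum.inter_filter) (rule finite_half_edges)
    also have "\<dots> = (\<Sum>h'\<in>{h, opposite h}. if endpt \<Gamma> h' = w then sign_mult (\<omega> h') (f (fst h')) else 0)"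
      using h off by (intro sum.mono_neutral_right) (simp_all add: finite_half_edges)
    also have "\<dots> = (if endpt \<Gamma> h = w then sign_mult (\<omega> h) (sign_mult (\<omega> h) x) else 0) +
        (if endpt \<Gamma> (opposite h) = w then sign_mult (\<omega> (opposite h)) (sign_mult (\<omega> h) x) else 0)"
    proof -
      \<comment> \<open>The half-edges of a loop differ as well, so the sum really has two
        terms.\<close>
      have "h \<noteq> opposite h" by (cases h) (simp add: opposite_def)
      then show ?thesis by (simp add: f_def)
    qed
    also have "sign_mult (\<omega> h) (sign_mult (\<omega> h) x) = x"
      by (simp add: sign_mult_def)
    also have "sign_mult (\<omega> (opposite h)) (sign_mult (\<omega> h) x) = - sign_mult (\<sigma> (fst h)) x"
      using orientation_cases[of h] orientation_cases[of "opposite h"] sign_eq_orientation[of h] h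
      by (auto simp: sign_mult_def)
    finally show ?thesis
      by (auto simp: point_def)
  qed
  then show ?thesis
    unfolding is_boundary_def by blast
qed

text \<open>Modulo boundaries, a weight moves along a walk at the cost of the sign of the walk.\<close>

lemma is_boundary_walk:
  "walk \<Gamma> u c v \<Longrightarrow> is_boundary (\<lambda>w. point u x w - point v (sign_mult (walk_sign \<sigma> c) x) w)"
proof (induction c arbitrary: u x)
  case Nil
  then show ?case by (simp add: is_boundary_zero)
next
  case (Cons h c)
  let ?u' = "endpt \<Gamma> (opposite h)" and ?x' = "sign_mult (\<sigma> (fst h)) x"
  have h: "h \<in> half_edges \<Gamma>" "endpt \<Gamma> h = u" and c: "walk \<Gamma> ?u' c v"
    using Cons.prems by auto
  have "sign_mult (walk_sign \<sigma> (h # c)) x = sign_mult (walk_sign \<sigma> c) ?x'"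
    using sign_mult_mult[OF walk_sign_cases[OF c] sign_cases] h(1)
    by (simp add: half_edges_iff mult.commute[of "\<sigma> (fst h)"])
  \<comment> \<open>The two boundaries telescope: the weights at \<open>?u'\<close> cancel.\<close>
  then show ?case
    using is_boundary_add[OF is_boundary_edge[OF h(1), of x] Cons.IH[OF c, of ?x']] h(2) by simp
qed

text \<open>Carried round an unbalanced closed walk, \<open>y\<close> returns as \<open>- y\<close>;
  the difference \<open>y + y\<close> is therefore a boundary at the root.\<close>

lemma is_boundary_allowed:
  assumes "x \<in> allowed r"
  shows "is_boundary (point r x)"
proof (cases "unbalanced_root r")
  case True
  then obtain c where c: "walk \<Gamma> r c r" "walk_sign \<sigma> c \<noteq> 1"
    by (auto simp: unbalanced_root_def)
  obtain y where "x = y + y"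
    using assms True by (auto simp: allowed_def doubles_def)
  moreover have "sign_mult (walk_sign \<sigma> c) y = - y"
    using c(2) by (simp add: sign_mult_def)
  ultimately have "point r y w - point r (sign_mult (walk_sign \<sigma> c) y) w = point r x w" for w
    by (simp add: point_def)
  then show ?thesis
    using is_boundary_walk[OF c(1), of y] by simp
next
  case False
  then have "x = 0" using assms by (simp add: allowed_def)
  then have "point r x = (\<lambda>_. 0)" by (auto simp: point_def)
  then show ?thesis by (simp add: is_boundary_zero)
qed

text \<open>Moving every weight of \<open>g\<close> to its root changes \<open>g\<close> by a
  boundary and leaves the root sums, which are boundaries by assumption.\<close>

lemma is_boundary_if_root_sums_allowed:
  assumes "\<And>r. r \<in> roots \<Longrightarrow> root_sum g r \<in> allowed r"
  shows "is_boundary g"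
proof -
  let ?y = "\<lambda>v. sign_mult (potential v) (g v)"
  have "is_boundary (\<lambda>w. point v (g v) w - point (root_of v) (?y v) w)" for v
    using walk_to_root[of v] is_boundary_walk by metis
  moreover have "is_boundary (point r (root_sum g r))" if "r \<in> roots" for r
    using assms that by (intro is_boundary_allowed)
  ultimately have "is_boundary (\<lambda>w. (\<Sum>v\<in>verts \<Gamma>. point v (g v) w - point (root_of v) (?y v) w) +
      (\<Sum>r\<in>roots. point r (root_sum g r) w))"
    by (intro is_boundary_add is_boundary_sum) (auto simp: finite_verts finite_roots)
  moreover have "(\<Sum>v\<in>verts \<Gamma>. point v (g v) w - point (root_of v) (?y v) w) +
      (\<Sum>r\<in>roots. point r (root_sum g r) w) = g w" if "w \<in> verts \<Gamma>" for w
  proof -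
    have "(\<Sum>v\<in>verts \<Gamma>. point (root_of v) (?y v) w) =
        (\<Sum>r\<in>roots. \<Sum>v\<in>root_class r. point (root_of v) (?y v) w)"
      by (rule sum_over_verts_by_root)
    also have "\<dots> = (\<Sum>r\<in>roots. \<Sum>v\<in>root_class r. point r (?y v) w)"
      by (intro sum.cong) (auto simp: root_class_def)
    also have "\<dots> = (\<Sum>r\<in>roots. point r (root_sum g r) w)"
      by (simp add: root_sum_def point_sum)
    finally have "(\<Sum>v\<in>verts \<Gamma>. point (root_of v) (?y v) w) = (\<Sum>r\<in>roots. point r (root_sum g r) w)" .
    moreover have "(\<Sum>v\<in>verts \<Gamma>. point v (g v) w) = g w"
      using that by (simp add: point_def finite_verts)
    ultimately show ?thesis
      by (simp add: sum_subtractf)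
  qed
  ultimately show ?thesis
    by (rule is_boundary_cong)
qed

section \<open>Counting\<close>

text \<open>Restriction to \<open>verts \<Gamma>\<close> places the image among the extensional
  functions, where it can be counted.\<close>

definition boundary_map :: "('e \<Rightarrow> 'g::ab_group_add) \<Rightarrow> 'v \<Rightarrow> 'g" where
  "boundary_map f = restrict (boundary \<Gamma> \<omega> f) (verts \<Gamma>)"

lemma boundary_map_image:
  "boundary_map ` (edges \<Gamma> \<rightarrow>\<^sub>E (UNIV :: 'g::ab_group_add set)) =
     {g \<in> verts \<Gamma> \<rightarrow>\<^sub>E UNIV. \<forall>r\<in>roots. root_sum g r \<in> allowed r}"
proof (intro equalityI subsetI)
  fix g :: "'v \<Rightarrow> 'g" assume "g \<in> boundary_map ` (edges \<Gamma> \<rightarrow>\<^sub>E UNIV)"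
  then obtain f where g: "g = boundary_map f" by blast
  have "root_sum g r = root_sum (boundary \<Gamma> \<omega> f) r" for r
    unfolding root_sum_def g boundary_map_def by (intro sum.cong) (auto simp: root_class_def)
  then show "g \<in> {g \<in> verts \<Gamma> \<rightarrow>\<^sub>E UNIV. \<forall>r\<in>roots. root_sum g r \<in> allowed r}"
    using root_sum_boundary_allowed by (auto simp: g boundary_map_def)
next
  fix g :: "'v \<Rightarrow> 'g"
  assume g: "g \<in> {g \<in> verts \<Gamma> \<rightarrow>\<^sub>E UNIV. \<forall>r\<in>roots. root_sum g r \<in> allowed r}"
  then have "is_boundary g"
    by (intro is_boundary_if_root_sums_allowed) auto
  then obtain f where f: "\<forall>v\<in>verts \<Gamma>. boundary \<Gamma> \<omega> f v = g v"
    unfolding is_boundary_def by blast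
  \<comment> \<open>The weight supplied by \<open>is_boundary\<close> may take any values off the
    edge set; making it extensional does not affect its boundary.\<close>
  have "boundary \<Gamma> \<omega> (restrict f (edges \<Gamma>)) v = boundary \<Gamma> \<omega> f v" for v
    by (rule boundary_cong) simp
  then have "boundary_map (restrict f (edges \<Gamma>)) = g"
    using f g unfolding boundary_map_def by (intro extensionalityI[of _ "verts \<Gamma>"]) (auto simp: PiE_def)
  then show "g \<in> boundary_map ` (edges \<Gamma> \<rightarrow>\<^sub>E UNIV)"
    by (metis UNIV_I image_eqI restrict_PiE_iff)
qed

section \<open>Fibres and image of the boundary map\<close>

lemma flows_eq: "flows \<Gamma> \<omega> = {f \<in> edges \<Gamma> \<rightarrow>\<^sub>E UNIV. \<forall>v\<in>verts \<Gamma>. boundary \<Gamma> \<omega> f v = 0}"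
  by (simp add: flows_def boundary_def)

text \<open>Every nonempty fibre is a coset of the flows; subtracting \<open>f0\<close>, restricted
  again to the edges, is the bijection.\<close>

lemma card_boundary_map_fibre:
  assumes f0: "f0 \<in> edges \<Gamma> \<rightarrow>\<^sub>E (UNIV :: 'g::ab_group_add set)"
  shows "card {f \<in> edges \<Gamma> \<rightarrow>\<^sub>E UNIV. boundary_map f = boundary_map f0} =
         card (flows \<Gamma> \<omega> :: ('e \<Rightarrow> 'g) set)"
proof -
  have eq_iff: "boundary_map f = boundary_map f0 \<longleftrightarrow>
      (\<forall>v\<in>verts \<Gamma>. boundary \<Gamma> \<omega> f v = boundary \<Gamma> \<omega> f0 v)" for f
    unfolding boundary_map_def by (metis restrict_apply' restrict_ext)
  have shift: "boundary \<Gamma> \<omega> (\<lambda>e\<in>edges \<Gamma>. f e - f0 e) v = boundary \<Gamma> \<omega> f v - boundary \<Gamma> \<omega> f0 v"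
    "boundary \<Gamma> \<omega> (\<lambda>e\<in>edges \<Gamma>. f e + f0 e) v = boundary \<Gamma> \<omega> f v + boundary \<Gamma> \<omega> f0 v" for f v
    unfolding boundary_diff[symmetric] boundary_add[symmetric] by (auto intro: boundary_cong)
  have "bij_betw (\<lambda>f. \<lambda>e\<in>edges \<Gamma>. f e - f0 e)
      {f \<in> edges \<Gamma> \<rightarrow>\<^sub>E UNIV. boundary_map f = boundary_map f0} (flows \<Gamma> \<omega>)"
  proof (rule bij_betw_byWitness[where f' = "\<lambda>f. \<lambda>e\<in>edges \<Gamma>. f e + f0 e"])
    show "\<forall>f\<in>{f \<in> edges \<Gamma> \<rightarrow>\<^sub>E UNIV. boundary_map f = boundary_map f0}.
        (\<lambda>e\<in>edges \<Gamma>. (\<lambda>e\<in>edges \<Gamma>. f e - f0 e) e + f0 e) = f"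
      by (auto simp: fun_eq_iff PiE_def extensional_def)
    show "\<forall>f\<in>flows \<Gamma> \<omega>. (\<lambda>e\<in>edges \<Gamma>. (\<lambda>e\<in>edges \<Gamma>. f e + f0 e) e - f0 e) = f"
      by (auto simp: flows_eq fun_eq_iff PiE_def extensional_def)
  qed (auto simp: flows_eq eq_iff shift)
  then show ?thesis
    by (rule bij_betw_same_card)
qed

text \<open>The domain is partitioned into the fibres over the image, all of the same size.\<close>

lemma card_flows_times_card_image:
  "card (flows \<Gamma> \<omega> :: ('e \<Rightarrow> 'g) set) *
     card (boundary_map ` (edges \<Gamma> \<rightarrow>\<^sub>E (UNIV :: 'g::{ab_group_add, finite} set))) =
   card (UNIV :: 'g set) ^ card (edges \<Gamma>)"
proof -
  let ?A = "edges \<Gamma> \<rightarrow>\<^sub>E (UNIV :: 'g set)"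
  have fin: "finite ?A" by (simp add: finite_PiE finite_edges)
  have "(\<Sum>g\<in>boundary_map ` ?A. card {f \<in> ?A. boundary_map f = g}) = card ?A"
    using sum.group[of ?A "boundary_map ` ?A" boundary_map "\<lambda>_. 1 :: nat"] fin by simp
  moreover have "(\<Sum>g\<in>boundary_map ` ?A. card {f \<in> ?A. boundary_map f = g}) =
      (\<Sum>g\<in>boundary_map ` ?A. card (flows \<Gamma> \<omega> :: ('e \<Rightarrow> 'g) set))"
    by (intro sum.cong) (auto simp: card_boundary_map_fibre)
  moreover have "card ?A = card (UNIV :: 'g set) ^ card (edges \<Gamma>)"
    by (simp add: card_PiE finite_edges)
  ultimately show ?thesis
    by (simp add: mult.commute)
qed

text \<open>
  Replacing the value at each root by the signed sum over its component is a bijection, which turns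
  the description of the image into a product of sets.
\<close>

lemma card_boundary_map_image:
  "card (boundary_map ` (edges \<Gamma> \<rightarrow>\<^sub>E (UNIV :: 'g::{ab_group_add, finite} set))) =
   card (doubles :: 'g set) ^ k_u \<Gamma> \<sigma> * card (UNIV :: 'g set) ^ (card (verts \<Gamma>) - card roots)"
proof -
  let ?A = "verts \<Gamma> \<rightarrow>\<^sub>E (UNIV :: 'g set)"
  define T :: "('v \<Rightarrow> 'g) \<Rightarrow> 'v \<Rightarrow> 'g"
    where "T g = (\<lambda>v\<in>verts \<Gamma>. if v \<in> roots then root_sum g v else g v)" for g
  define P :: "'v \<Rightarrow> 'g set" where "P v = (if v \<in> roots then allowed v else UNIV)" for v
  have fin: "finite ?A" by (simp add: finite_PiE finite_verts)
  have "inj_on T ?A"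
  proof (rule inj_onI)
    fix g g' assume gA: "g \<in> ?A" "g' \<in> ?A" and T: "T g = T g'"
    have T_eq: "(if v \<in> roots then root_sum g v else g v) =
        (if v \<in> roots then root_sum g' v else g' v)" if "v \<in> verts \<Gamma>" for v
      using fun_cong[OF T, of v] that by (simp add: T_def)
    have off: "g v = g' v" if "v \<in> verts \<Gamma>" "v \<notin> roots" for v
      using T_eq[OF that(1)] that(2) by simp
    have on: "g r = g' r" if r: "r \<in> roots" for r
    proof -
      \<comment> \<open>Once all non-root values agree, the root sum determines the value at the
        root up to a fixed sign, and that sign cancels.\<close>
      have split: "root_sum k r = sign_mult (potential r) (k r) +
          (\<Sum>v\<in>root_class r - {r}. sign_mult (potential v) (k v))" for k :: "'v \<Rightarrow> 'g"
        unfolding root_sum_def by (rule sum.remove[OF finite_root_class root_in_class[OF r]])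
      have "(\<Sum>v\<in>root_class r - {r}. sign_mult (potential v) (g v)) =
          (\<Sum>v\<in>root_class r - {r}. sign_mult (potential v) (g' v))"
      proof (rule sum.cong)
        fix v assume v: "v \<in> root_class r - {r}"
        then have "v \<notin> roots" using root_of_root by (auto simp: root_class_def)
        then show "sign_mult (potential v) (g v) = sign_mult (potential v) (g' v)"
          using off v by (simp add: root_class_def)
      qed simp
      moreover have "root_sum g r = root_sum g' r"
        using T_eq[of r] r roots_subset by auto
      ultimately show ?thesis
        by (simp add: split sign_mult_cancel)
    qed
    show "g = g'"
      using gA on off by (intro PiE_ext) blast+
  qed
  moreover have "T ` ?A \<subseteq> ?A" by (auto simp: T_def)
  \<comment> \<open>An injective self-map of a finite set is surjective, so no inverse of
    \<open>T\<close> has to be written down.\<close>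
  ultimately have onto: "T ` ?A = ?A"
    using fin endo_inj_surj by blast
  have member: "T g \<in> PiE (verts \<Gamma>) P \<longleftrightarrow> (\<forall>r\<in>roots. root_sum g r \<in> allowed r)" for g
    using roots_subset by (auto simp: T_def P_def PiE_iff)
  have image: "T ` {g \<in> ?A. \<forall>r\<in>roots. root_sum g r \<in> allowed r} = PiE (verts \<Gamma>) P"
  proof -
    have "PiE (verts \<Gamma>) P \<subseteq> ?A" by (auto simp: PiE_iff)
    moreover have "T ` {g \<in> ?A. T g \<in> PiE (verts \<Gamma>) P} = T ` ?A \<inter> PiE (verts \<Gamma>) P" by blast
    ultimately show ?thesis unfolding member onto by (simp only: Int_absorb1)
  qed
  have inj: "inj_on T {g \<in> ?A. \<forall>r\<in>roots. root_sum g r \<in> allowed r}"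
    using \<open>inj_on T ?A\<close> by (rule inj_on_subset) blast
  have "card (boundary_map ` (edges \<Gamma> \<rightarrow>\<^sub>E (UNIV :: 'g set))) = card (PiE (verts \<Gamma>) P)"
    unfolding boundary_map_image image[symmetric] by (rule card_image[OF inj, symmetric])
  also have "\<dots> = (\<Prod>v\<in>verts \<Gamma>. card (P v))"
    by (rule card_PiE[OF finite_verts])
  also have "\<dots> = (\<Prod>v\<in>verts \<Gamma> - roots. card (P v)) * (\<Prod>v\<in>roots. card (P v))"
    by (rule prod.subset_diff[OF roots_subset finite_verts])
  also have "(\<Prod>v\<in>verts \<Gamma> - roots. card (P v)) = card (UNIV :: 'g set) ^ (card (verts \<Gamma>) - card roots)"
    by (simp add: P_def card_Diff_subset[OF finite_roots roots_subset])
  also have "(\<Prod>v\<in>roots. card (P v)) =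
      (\<Prod>v\<in>roots. if unbalanced_root v then card (doubles :: 'g set) else 1)"
    by (intro prod.cong) (auto simp: P_def allowed_def)
  also have "\<dots> = card (doubles :: 'g set) ^ k_u \<Gamma> \<sigma>"
    by (simp add: k_u_eq prod.inter_filter[OF finite_roots, symmetric])
  finally show ?thesis
    by simp
qed

lemma card_roots: "card roots = k_b \<Gamma> \<sigma> + k_u \<Gamma> \<sigma>"
proof -
  have "roots = {r \<in> roots. \<not> unbalanced_root r} \<union> {r \<in> roots. unbalanced_root r}" by blast
  then show ?thesis
    unfolding k_b_eq k_u_eq using finite_roots
    by (subst card_Un_disjoint[symmetric]) auto
qed

end

theorem theorem5p1:
  fixes \<Gamma> :: "('v, 'e) multigraph"
    and \<sigma> :: "'e \<Rightarrow> int"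
    and \<omega> :: "'e \<times> bool \<Rightarrow> int"
  assumes "signed_graph \<Gamma> \<sigma>"
    and "compatible_orientation \<Gamma> \<sigma> \<omega>"
  shows "real (card (flows \<Gamma> \<omega> :: ('e \<Rightarrow> 'g::{ab_group_add, finite}) set)) =
    real (card (UNIV :: 'g set))
        powi (int (card (edges \<Gamma>)) - int (card (verts \<Gamma>)) + int (k_b \<Gamma> \<sigma>)) *
      (real (card (UNIV :: 'g set)) / real (card {x + x | x :: 'g. True})) ^ k_u \<Gamma> \<sigma>"
proof -
  interpret oriented_signed_graph \<Gamma> \<sigma> \<omega>
    using assms by unfold_locales
  let ?F = "card (flows \<Gamma> \<omega> :: ('e \<Rightarrow> 'g) set)"
  let ?N = "real (card (UNIV :: 'g set))" and ?M = "real (card (doubles :: 'g set))"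
  let ?kb = "k_b \<Gamma> \<sigma>" and ?ku = "k_u \<Gamma> \<sigma>"
  have N: "?N \<noteq> 0" by simp
  have "(doubles :: 'g set) \<noteq> {}" by (auto simp: doubles_def)
  then have M: "?M \<noteq> 0" by simp
  \<comment> \<open>Roots are vertices, so the truncated subtraction in the exponent agrees with
    subtraction of integers.\<close>
  have le: "?kb + ?ku \<le> card (verts \<Gamma>)"
    using card_mono[OF finite_verts roots_subset] by (simp add: card_roots)
  have "?F * (card (doubles :: 'g set) ^ ?ku * card (UNIV :: 'g set) ^ (card (verts \<Gamma>) - (?kb + ?ku))) =
      card (UNIV :: 'g set) ^ card (edges \<Gamma>)"
    using card_flows_times_card_image[where 'g = 'g] by (simp add: card_boundary_map_image card_roots)
  then have "real ?F * (?M ^ ?ku * ?N ^ (card (verts \<Gamma>) - (?kb + ?ku))) = ?N ^ card (edges \<Gamma>)"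
    by (metis of_nat_mult of_nat_power)
  then have "real ?F = ?N ^ card (edges \<Gamma>) / ?N ^ (card (verts \<Gamma>) - (?kb + ?ku)) / ?M ^ ?ku"
    using N M by (simp add: field_simps)
  also have "?N ^ card (edges \<Gamma>) / ?N ^ (card (verts \<Gamma>) - (?kb + ?ku)) =
      ?N powi (int (card (edges \<Gamma>)) - int (card (verts \<Gamma>) - (?kb + ?ku)))"
    using N by (simp add: power_int_diff)
  \<comment> \<open>Splitting off \<open>?ku\<close> from the exponent supplies one factor
    \<open>?N\<close> for each \<open>?M\<close> in the denominator, which gives the quotient
    |G|/|2G|.\<close>
  also have "int (card (edges \<Gamma>)) - int (card (verts \<Gamma>) - (?kb + ?ku)) =
      (int (card (edges \<Gamma>)) - int (card (verts \<Gamma>)) + int ?kb) + int ?ku"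
    using le by (simp add: of_nat_diff)
  also have "?N powi \<dots> = ?N powi (int (card (edges \<Gamma>)) - int (card (verts \<Gamma>)) + int ?kb) * ?N ^ ?ku"
    using N by (simp add: power_int_add)
  finally show ?thesis
    unfolding doubles_def by (simp add: power_divide)
qed

end
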